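(* Let $G$ be a finite simple graph with $n=|V(G)|\ge 1$ vertices, and for integers $p\ge 0$ let $Z_p(G)=\sum_{v\in V(G)}\deg(v)^p$ (with $0^0=1$, so $Z_0(G)=n$). Let $\mathcal{G}(Z,t)=\sum_{p=0}^{\infty} Z_p(G)t^p$. Then (i) \[ \mathcal{G}(Z,t)=\frac{\displaystyle\sum_{k=0}^{n-1}\left(\sum_{i=0}^{k}\left[ {n+1 \atop n+1-(k-i)}\right] Z_i(G)\right)t^k}{(1-t)(1-2t)\cdots(1-nt)}; \] (ii) for all $p>n$, \[ Z_p(G)+\sum_{i=1}^{n}\left[ {n+1 \atop n+1-i}\right] Z_{p-i}(G)=0. \]
   Context: $\left[ {N \atop k}\right]$ denotes the signed Stirling number of the first kind, defined by $x(x-1)\cdots(x-N+1)=\sum_{k}\left[ {N \atop k}\right]x^k$; in particular $(1-t)(1-2t)\cdots(1-nt)=\sum_{i=0}^{n}\left[ {n+1 \atop n+1-i}\right]t^i$.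
   Formalization: Formula (i) as printed fails when G has an isolated vertex (for K_1 the series is 1, not 1/(1-t)); it is proved as printed for graphs with no vertex of degree 0, and for all graphs with the numerator sum running up to k = n instead of n-1. *)

theory Defs
  imports
    "Graph_Theory.Digraph"
    "HOL-Computational_Algebra.Computational_Algebra"
begin

definition signed_stirling :: "nat \<Rightarrow> nat \<Rightarrow> int" where
  "signed_stirling N k = coeff (\<Prod>j<N. [:- int j, 1:]) k"

lemma signed_stirling_expansion:
  fixes x :: int
  shows "(\<Prod>j<N. x - int j) = (\<Sum>k\<le>N. signed_stirling N k * x ^ k)"
proof -
  let ?P = "\<Prod>j<N. [:- int j, 1:]"
  have "degree ?P = N"
    by (subst degree_prod_eq_sum_degree) auto
  then have "poly ?P x = (\<Sum>k\<le>N. signed_stirling N k * x ^ k)"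
    by (simp add: poly_altdef signed_stirling_def)
  then show ?thesis
    by (simp add: poly_prod algebra_simps)
qed

text \<open>
  Finite simple graphs are the \<^locale>\<open>graph\<close> structures of the library, i.e. finite symmetric
  digraphs without loops and parallel arcs. Each undirected edge is a pair of opposite arcs, so
  the number of arcs leaving a vertex is its degree in the undirected sense.
\<close>

abbreviation vertex_degree :: "('a, 'b) pre_digraph \<Rightarrow> 'a \<Rightarrow> nat" where
  "vertex_degree \<equiv> out_degree"

definition zagreb :: "('a, 'b) pre_digraph \<Rightarrow> nat \<Rightarrow> int" where
  "zagreb G p = (\<Sum>v\<in>verts G. int (vertex_degree G v) ^ p)"

definition zagreb_gf :: "('a, 'b) pre_digraph \<Rightarrow> rat fps" where
  "zagreb_gf G = Abs_fps (\<lambda>p. of_int (zagreb G p))"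

text \<open>
  An isolated vertex contributes the constant series \<open>1\<close> to the generating function. Over the
  denominator \<open>(1 - t)(1 - 2t)\<cdots>(1 - nt)\<close> this is a numerator of degree \<open>n\<close>, so a numerator of
  degree at most \<open>n - 1\<close> suffices only in the absence of isolated vertices; the one-vertex graph
  already shows this.
\<close>

lemma one_vertex_numerator_degree:
  fixes v :: 'a and s t :: "'b \<Rightarrow> 'a"
  defines "G \<equiv> \<lparr>verts = {v}, arcs = {}, tail = s, head = t\<rparr>" and "n \<equiv> 1"
  shows "graph G" and "card (verts G) = n"
    and "zagreb_gf G \<noteq>
      (\<Sum>k = 0..n - 1. fps_const (of_int (\<Sum>i = 0..k.
          signed_stirling (n + 1) (n + 1 - (k - i)) * zagreb G i)) * fps_X ^ k)
      / (\<Prod>j = 1..n. 1 - of_nat j * fps_X)"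
proof -
  show "graph G"
    by unfold_locales (auto simp: G_def symmetric_conv arc_to_ends_def)
  show "card (verts G) = n"
    by (simp add: G_def n_def)
  have Z: "zagreb G p = (if p = 0 then 1 else 0)" for p
    by (simp add: zagreb_def G_def out_degree_def out_arcs_def power_0_left)
  have "zagreb_gf G = 1"
    by (rule fps_ext) (simp add: zagreb_gf_def Z)
  moreover have "signed_stirling 2 2 = 1"
    by (simp add: signed_stirling_def numeral_2_eq_2)
  moreover have "(1::rat fps) \<noteq> inverse (1 - fps_X)"
  proof
    assume "(1::rat fps) = inverse (1 - fps_X)"
    then have "(1 - fps_X) * 1 = (1 - fps_X) * inverse (1 - fps_X :: rat fps)"
      by simp
    also have "\<dots> = 1"
      by (simp add: inverse_mult_eq_1')
    finally have "fps_nth (1 - fps_X :: rat fps) 1 = fps_nth 1 1"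
      by simp
    then show False by simp
  qed
  ultimately show "zagreb_gf G \<noteq>
      (\<Sum>k = 0..n - 1. fps_const (of_int (\<Sum>i = 0..k.
          signed_stirling (n + 1) (n + 1 - (k - i)) * zagreb G i)) * fps_X ^ k)
      / (\<Prod>j = 1..n. 1 - of_nat j * fps_X)"
    by (simp add: n_def Z numeral_2_eq_2 fps_divide_unit)
qed

end

theory Submission
  imports Defs
begin

text \<open>
  With \<open>n\<close> vertices every degree \<open>d\<close> satisfies \<open>0 \<le> d < n\<close>, so it is a root of
  \<open>x(x - 1)\<cdots>(x - n)\<close>. Multiplying this equation by \<open>d\<^bsup>p-n-1\<^esup>\<close> and summing over the vertices
  gives the recurrence for \<open>p > n\<close>; for \<open>d \<noteq> 0\<close> one may also divide by \<open>d\<close>, which gives it for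
  \<open>p = n\<close>. The left-hand side of the recurrence is the coefficient of \<open>t\<^sup>p\<close> in the product of the
  generating function with \<open>(1 - t)(1 - 2t)\<cdots>(1 - nt)\<close>, which is thus a polynomial.
\<close>

lemma signed_stirling_Suc_0 [simp]: "signed_stirling (Suc N) 0 = 0"
  by (simp add: signed_stirling_def poly_prod flip: poly_0_coeff_0 del: prod.lessThan_Suc)

lemma signed_stirling_Suc_Suc:
  "signed_stirling (Suc N) (Suc k) = signed_stirling N k - int N * signed_stirling N (Suc k)"
  by (simp add: signed_stirling_def)

lemma signed_stirling_eq_0: "N < k \<Longrightarrow> signed_stirling N k = 0"
  unfolding signed_stirling_def
  by (rule coeff_eq_0, subst degree_prod_eq_sum_degree) auto

lemma signed_stirling_self [simp]: "signed_stirling N N = 1"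
  by (induction N) (simp_all add: signed_stirling_Suc_Suc signed_stirling_eq_0,
    simp add: signed_stirling_def)

text \<open>The product is the reversal of \<open>x(x - 1)...(x - n)\<close>. Truncated subtraction
  makes the formula valid for every \<open>i\<close>: beyond \<open>n\<close> the index is 0, where
  the Stirling number vanishes.\<close>

lemma fps_nth_prod_one_minus:
  "fps_nth (\<Prod>j = 1..n. 1 - of_nat j * fps_X :: 'a::comm_ring_1 fps) i
    = of_int (signed_stirling (n + 1) (n + 1 - i))"
proof (induction n arbitrary: i)
  case 0
  show ?case by (cases i) simp_all
next
  case (Suc n)
  let ?D = "\<Prod>j = 1..n. 1 - of_nat j * fps_X :: 'a fps"
  have "(\<Prod>j = 1..Suc n. 1 - of_nat j * fps_X :: 'a fps)
      = ?D - fps_const (of_nat (Suc n)) * (fps_X * ?D)"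
    by (simp add: algebra_simps flip: fps_of_nat)
  then have nth: "fps_nth (\<Prod>j = 1..Suc n. 1 - of_nat j * fps_X :: 'a fps) i
      = fps_nth ?D i - of_nat (Suc n) * (if i = 0 then 0 else fps_nth ?D (i - 1))"
    by (simp only: fps_sub_nth fps_mult_left_const_nth fps_X_mult_nth)
  show ?case
  proof (cases "i = 0 \<or> i > Suc n")
    case True
    then show ?thesis
      unfolding nth Suc.IH by auto
  next
    case False
    then obtain m where m: "n + 1 - i = m" "n + 1 - (i - 1) = Suc m" "Suc n + 1 - i = Suc m" "i \<noteq> 0"
      by fastforce
    then show ?thesis
      unfolding nth Suc.IH by (simp add: signed_stirling_Suc_Suc)
  qed
qed

text \<open>For \<open>d = 0\<close> the bound \<open>p > n\<close> keeps all exponents positive; at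
  \<open>p = n\<close> the term \<open>i = n\<close> would contain \<open>0 ^ 0 = 1\<close>.\<close>

lemma sum_signed_stirling_mult_power_eq_0:
  assumes "d \<le> n" and "d \<noteq> 0 \<or> p > n" and "n \<le> p"
  shows "(\<Sum>i = 0..n. signed_stirling (n + 1) (n + 1 - i) * int d ^ (p - i)) = 0"
proof (cases "d = 0")
  case True
  with assms show ?thesis
    by (auto intro!: sum.neutral)
next
  case False
  let ?s = "signed_stirling (n + 1)"
  have "0 = (\<Prod>j<n + 1. int d - int j)"
    using assms(1) by auto
  also have "\<dots> = (\<Sum>k\<le>n. ?s (Suc k) * int d ^ Suc k)"
    by (simp add: signed_stirling_expansion sum.atMost_Suc_shift del: sum.atMost_Suc)
  also have "\<dots> = (\<Sum>i\<le>n. ?s (n + 1 - i) * int d ^ (n + 1 - i))"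
    by (subst sum.nat_diff_reindex[symmetric, of _ "Suc n", unfolded lessThan_Suc_atMost])
      (auto intro!: sum.cong simp: Suc_diff_le)
  finally have "(\<Sum>i = 0..n. ?s (n + 1 - i) * int d ^ (n + 1 - i)) = 0"
    by (simp add: atLeast0AtMost)
  then have "0 = int d ^ (p - n) * (\<Sum>i = 0..n. ?s (n + 1 - i) * int d ^ (n + 1 - i))"
    by simp
  \<comment> \<open>The total exponent is \<open>p + 1 - i\<close>. Splitting off one factor
    \<open>d\<close>, cancelled at the end, also covers \<open>p = n\<close>.\<close>
  also have "\<dots> = int d * (\<Sum>i = 0..n. ?s (n + 1 - i) * int d ^ (p - i))"
  proof -
    have "int d ^ (p - n) * int d ^ (n + 1 - i) = int d * int d ^ (p - i)" if "i \<le> n" for i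
      using that \<open>n \<le> p\<close> by (simp add: Suc_diff_le flip: power_add power_Suc)
    then show ?thesis
      by (auto simp: sum_distrib_left mult_ac intro!: sum.cong)
  qed
  finally show ?thesis
    using False by simp
qed

text \<open>Without parallel arcs, arcs leaving \<open>v\<close> are determined by their heads, and
  without loops no head is \<open>v\<close>.\<close>

lemma (in graph) out_degree_less_card_verts:
  assumes "v \<in> verts G"
  shows "out_degree G v < card (verts G)"
proof -
  have "inj_on (head G) (out_arcs G v)"
    using no_multi_arcs by (auto simp: inj_on_def arc_to_ends_def)
  moreover have "head G ` out_arcs G v \<subseteq> verts G - {v}"
    using no_loops by auto
  ultimately have "out_degree G v \<le> card (verts G - {v})"
    unfolding out_degree_def by (intro card_inj_on_le) auto
  also have "\<dots> < card (verts G)"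
    using assms by (intro psubset_card_mono) auto
  finally show ?thesis .
qed

lemma (in graph) zagreb_recurrence:
  assumes "n = card (verts G)" and "n \<le> p"
    and "p > n \<or> (\<forall>v\<in>verts G. vertex_degree G v \<noteq> 0)"
  shows "(\<Sum>i = 0..n. signed_stirling (n + 1) (n + 1 - i) * zagreb G (p - i)) = 0"
proof -
  have "(\<Sum>i = 0..n. signed_stirling (n + 1) (n + 1 - i) * zagreb G (p - i))
      = (\<Sum>v\<in>verts G. \<Sum>i = 0..n.
          signed_stirling (n + 1) (n + 1 - i) * int (vertex_degree G v) ^ (p - i))"
    unfolding zagreb_def sum_distrib_left by (rule sum.swap)
  also have "\<dots> = 0"
    using assms out_degree_less_card_verts
    by (intro sum.neutral ballI sum_signed_stirling_mult_power_eq_0) (auto intro: less_imp_le)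
  finally show ?thesis .
qed

lemma fps_nth_zagreb_gf_mult:
  "fps_nth (zagreb_gf G * (\<Prod>j = 1..n. 1 - of_nat j * fps_X)) k
    = of_int (\<Sum>i = 0..k. signed_stirling (n + 1) (n + 1 - (k - i)) * zagreb G i)"
  unfolding fps_mult_nth fps_nth_prod_one_minus zagreb_gf_def
  by (simp add: mult.commute)

lemma (in graph) zagreb_numerator_eq_0:
  assumes "n = card (verts G)" and "n \<le> k"
    and "k > n \<or> (\<forall>v\<in>verts G. vertex_degree G v \<noteq> 0)"
  shows "(\<Sum>i = 0..k. signed_stirling (n + 1) (n + 1 - (k - i)) * zagreb G i) = 0"
proof -
  have "(\<Sum>i = 0..k. signed_stirling (n + 1) (n + 1 - (k - i)) * zagreb G i)
      = (\<Sum>i = 0..k. signed_stirling (n + 1) (n + 1 - i) * zagreb G (k - i))"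
    by (rule sum.reindex_bij_witness[of _ "\<lambda>i. k - i" "\<lambda>i. k - i"]) auto
  \<comment> \<open>For \<open>i > n\<close> the truncated index is 0, so the coefficient
    vanishes.\<close>
  also have "\<dots> = (\<Sum>i = 0..n. signed_stirling (n + 1) (n + 1 - i) * zagreb G (k - i))"
    using assms(2) by (intro sum.mono_neutral_right) auto
  also have "\<dots> = 0"
    using assms by (rule zagreb_recurrence)
  finally show ?thesis .
qed

text \<open>The bound \<open>m\<close> is a parameter so that both numerator degrees,
  \<open>n - 1\<close> and \<open>n\<close>, are covered.\<close>

lemma zagreb_gf_eq_divide:
  assumes "\<And>k. k > m \<Longrightarrow>
    (\<Sum>i = 0..k. signed_stirling (n + 1) (n + 1 - (k - i)) * zagreb G i) = 0"
  shows "zagreb_gf G =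
    (\<Sum>k = 0..m. fps_const (of_int (\<Sum>i = 0..k.
        signed_stirling (n + 1) (n + 1 - (k - i)) * zagreb G i)) * fps_X ^ k)
    / (\<Prod>j = 1..n. 1 - of_nat j * fps_X)" (is "_ = ?N / ?D")
proof -
  have "zagreb_gf G * ?D = ?N"
  proof (rule fps_ext)
    fix k
    show "fps_nth (zagreb_gf G * ?D) k = fps_nth ?N k"
      using assms[of k] unfolding fps_nth_zagreb_gf_mult
      by (simp add: fps_sum_nth fps_X_power_nth if_distrib del: of_int_sum cong: if_cong)
  qed
  moreover have "fps_nth ?D 0 \<noteq> 0"
    unfolding fps_nth_prod_one_minus by simp
  then have "?D \<noteq> 0"
    by (rule fps_nonzeroI)
  ultimately show ?thesis
    by (metis nonzero_mult_div_cancel_right)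
qed

text \<open>The numerator coefficient at \<open>k = n\<close> is
  \<open>signed_stirling (n + 1) 1\<close> times the number of isolated vertices, which is why the
  first formula assumes that there are none and the second keeps this term.\<close>

theorem theorem5:
  fixes G :: "('a, 'b) pre_digraph" and n :: nat
  assumes "graph G" and "n = card (verts G)" and "n \<ge> 1"
  shows
    "((\<forall>v\<in>verts G. vertex_degree G v \<noteq> 0) \<longrightarrow>
        zagreb_gf G =
          (\<Sum>k = 0..n - 1. fps_const (of_int (\<Sum>i = 0..k.
              signed_stirling (n + 1) (n + 1 - (k - i)) * zagreb G i)) * fps_X ^ k)
          / (\<Prod>j = 1..n. 1 - of_nat j * fps_X))
     \<and> zagreb_gf G =
          (\<Sum>k = 0..n. fps_const (of_int (\<Sum>i = 0..k.
              signed_stirling (n + 1) (n + 1 - (k - i)) * zagreb G i)) * fps_X ^ k)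
          / (\<Prod>j = 1..n. 1 - of_nat j * fps_X)
     \<and> (\<forall>p > n. zagreb G p
          + (\<Sum>i = 1..n. signed_stirling (n + 1) (n + 1 - i) * zagreb G (p - i)) = 0)"
proof -
  interpret graph G by fact
  have rec: "zagreb G p
      + (\<Sum>i = 1..n. signed_stirling (n + 1) (n + 1 - i) * zagreb G (p - i)) = 0" if "p > n" for p
    using zagreb_recurrence[of n p] that \<open>n = card (verts G)\<close>
    by (simp add: sum.atLeast_Suc_atMost)
  show ?thesis
    using \<open>n \<ge> 1\<close> \<open>n = card (verts G)\<close>
    by (intro conjI allI impI rec zagreb_gf_eq_divide zagreb_numerator_eq_0) auto
qed

end
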